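(* Let $(X,\mathcal{A},m)$ be a non-atomic Lebesgue probability space and let $T$ be an ergodic automorphism of $(X,\mathcal{A},m)$. Then the set of coboundaries $\mathcal{B}=\{T(B)+B : B\in\mathcal{A}\}$ is meager in the complete metric space $(\mathcal{A},d)$, where $d(A,B)=m(A+B)$ and $+$ is symmetric difference.
   Context: A non-atomic Lebesgue probability space is a standard non-atomic probability space (isomorphic mod null sets to $[0,1]$ with Lebesgue measure). Measurable sets that agree up to a set of measure zero are identified, so $\mathcal{A}$ denotes the measure algebra; it is an abelian group under symmetric difference $A+B=A\,\triangle\,B$, and with $d(A,B)=m(A+B)$ it is a complete separable metric space. An automorphism $T$ of $(X,\mathcal{A},m)$ is an invertible (mod null sets) bi-measurable map $T:X\to X$ with $m(T(A))=m(A)$ for all $A\in\mathcal{A}$. $T$ is ergodic if $\emptyset$ and $X$ are the only elements $A\in\mathcal{A}$ with $T(A)=A$ (mod null sets). A set is meager if it is a countable union of nowhere dense sets. *)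

theory Defs
  imports "HOL-Probability.Probability"
begin

section \<open>The measure algebra\<close>

definition eq_mod_null :: "'a measure \<Rightarrow> ('a set \<times> 'a set) set" where
  "eq_mod_null M = {(A, B). A \<in> sets M \<and> B \<in> sets M \<and> sym_diff A B \<in> null_sets M}"

definition malg :: "'a measure \<Rightarrow> 'a set set set" where
  "malg M = sets M // eq_mod_null M"

definition malg_class :: "'a measure \<Rightarrow> 'a set \<Rightarrow> 'a set set" where
  "malg_class M A = eq_mod_null M `` {A}"

definition malg_add :: "'a measure \<Rightarrow> 'a set set \<Rightarrow> 'a set set \<Rightarrow> 'a set set" where
  "malg_add M a b = (\<Union>A\<in>a. \<Union>B\<in>b. malg_class M (sym_diff A B))"

definition malg_measure :: "'a measure \<Rightarrow> 'a set set \<Rightarrow> real" where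
  "malg_measure M a = measure M (SOME A. A \<in> a)"

definition malg_dist :: "'a measure \<Rightarrow> 'a set set \<Rightarrow> 'a set set \<Rightarrow> real" where
  "malg_dist M a b = malg_measure M (malg_add M a b)"

lemma eq_mod_null_iff:
  "(A, B) \<in> eq_mod_null M \<longleftrightarrow> A \<in> sets M \<and> B \<in> sets M \<and> sym_diff A B \<in> null_sets M"
  by (simp add: eq_mod_null_def)

lemma sym_diff_null_cong:
  assumes "sym_diff A A' \<in> null_sets M" "sym_diff B B' \<in> null_sets M"
    and "A \<in> sets M" "A' \<in> sets M" "B \<in> sets M" "B' \<in> sets M"
  shows "sym_diff (sym_diff A B) (sym_diff A' B') \<in> null_sets M"
  by (rule null_sets_subset[OF null_sets.Un[OF assms(1,2)]]) (use assms in auto)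

lemma equiv_eq_mod_null: "equiv (sets M) (eq_mod_null M)"
proof (rule equivI)
  show "eq_mod_null M \<subseteq> sets M \<times> sets M"
    by (auto simp: eq_mod_null_def)
  show "refl_on (sets M) (eq_mod_null M)"
    by (auto simp: refl_on_def eq_mod_null_def)
  show "sym (eq_mod_null M)"
    by (auto simp: sym_def eq_mod_null_def Un_commute)
  show "trans (eq_mod_null M)"
  proof (rule transI)
    fix A B C assume "(A, B) \<in> eq_mod_null M" "(B, C) \<in> eq_mod_null M"
    then have *: "A \<in> sets M" "C \<in> sets M"
      "sym_diff A B \<in> null_sets M" "sym_diff B C \<in> null_sets M"
      by (auto simp: eq_mod_null_iff)
    have "sym_diff A C \<in> null_sets M"
      by (rule null_sets_subset[OF null_sets.Un[OF *(3,4)]]) (use * in auto)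
    then show "(A, C) \<in> eq_mod_null M"
      using * by (simp add: eq_mod_null_iff)
  qed
qed

lemma mem_malg_class:
  "B \<in> malg_class M A \<longleftrightarrow> A \<in> sets M \<and> B \<in> sets M \<and> sym_diff A B \<in> null_sets M"
  by (simp add: malg_class_def eq_mod_null_iff)

lemma malg_class_self: "A \<in> sets M \<Longrightarrow> A \<in> malg_class M A"
  by (simp add: mem_malg_class)

lemma malg_class_in_malg: "A \<in> sets M \<Longrightarrow> malg_class M A \<in> malg M"
  by (simp add: malg_class_def malg_def quotientI)

lemma malg_cases:
  assumes "a \<in> malg M"
  obtains A where "A \<in> sets M" "a = malg_class M A"
  using assms by (auto simp: malg_def malg_class_def quotient_def)

lemma malg_class_eq_iff:
  assumes "A \<in> sets M" "B \<in> sets M"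
  shows "malg_class M A = malg_class M B \<longleftrightarrow> sym_diff A B \<in> null_sets M"
  using eq_equiv_class_iff[OF equiv_eq_mod_null assms] assms
  by (simp add: malg_class_def eq_mod_null_iff)

lemma malg_add_class:
  assumes "A \<in> sets M" "B \<in> sets M"
  shows "malg_add M (malg_class M A) (malg_class M B) = malg_class M (sym_diff A B)"
proof -
  have "malg_class M (sym_diff A' B') = malg_class M (sym_diff A B)"
    if "A' \<in> malg_class M A" "B' \<in> malg_class M B" for A' B'
  proof -
    have *: "A' \<in> sets M" "B' \<in> sets M"
      "sym_diff A A' \<in> null_sets M" "sym_diff B B' \<in> null_sets M"
      using that by (simp_all add: mem_malg_class)
    have "sym_diff (sym_diff A B) (sym_diff A' B') \<in> null_sets M"
      by (rule sym_diff_null_cong) (use * assms in auto)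
    then have "malg_class M (sym_diff A B) = malg_class M (sym_diff A' B')"
      using * assms by (subst malg_class_eq_iff) auto
    then show ?thesis ..
  qed
  then show ?thesis
    using malg_class_self[OF assms(1)] malg_class_self[OF assms(2)]
    unfolding malg_add_def by blast
qed

lemma malg_measure_class:
  assumes "A \<in> sets M"
  shows "malg_measure M (malg_class M A) = measure M A"
proof -
  let ?B = "SOME B. B \<in> malg_class M A"
  have "?B \<in> malg_class M A"
    using malg_class_self[OF assms] by (rule someI)
  then have B: "?B \<in> sets M" "sym_diff A ?B \<in> null_sets M"
    unfolding mem_malg_class by blast+
  have "AE x in M. x \<notin> sym_diff A ?B"
    using B(2) by (rule AE_not_in)
  then have "AE x in M. x \<in> A \<longleftrightarrow> x \<in> ?B"
    by eventually_elim auto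
  then show ?thesis
    unfolding malg_measure_def using assms B(1) by (intro measure_eq_AE) auto
qed

lemma malg_dist_class:
  assumes "A \<in> sets M" "B \<in> sets M"
  shows "malg_dist M (malg_class M A) (malg_class M B) = measure M (sym_diff A B)"
  unfolding malg_dist_def malg_add_class[OF assms]
  by (rule malg_measure_class) (use assms in auto)

lemma Metric_space_malg:
  fixes M :: "'a measure"
  assumes "finite_measure M"
  shows "Metric_space (malg M) (malg_dist M)"
proof
  interpret finite_measure M by fact
  fix x y z
  show "0 \<le> malg_dist M x y"
    by (simp add: malg_dist_def malg_measure_def)
  have "sym_diff A B = sym_diff B A" for A B :: "'a set" by blast
  then have "malg_add M x y = malg_add M y x"
    unfolding malg_add_def by (metis (no_types, lifting) SUP_commute SUP_cong)
  then show "malg_dist M x y = malg_dist M y x"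
    by (simp add: malg_dist_def)
  show "malg_dist M x y = 0 \<longleftrightarrow> x = y" if xy: "x \<in> malg M" "y \<in> malg M"
  proof -
    obtain A where A: "A \<in> sets M" "x = malg_class M A" using xy(1) by (rule malg_cases)
    obtain B where B: "B \<in> sets M" "y = malg_class M B" using xy(2) by (rule malg_cases)
    have "sym_diff A B \<in> sets M" using A B by auto
    then show ?thesis
      using A B by (simp add: malg_dist_class malg_class_eq_iff null_sets_def emeasure_eq_measure)
  qed
  show "malg_dist M x z \<le> malg_dist M x y + malg_dist M y z"
    if xyz: "x \<in> malg M" "y \<in> malg M" "z \<in> malg M"
  proof -
    obtain A where A: "A \<in> sets M" "x = malg_class M A" using xyz(1) by (rule malg_cases)
    obtain B where B: "B \<in> sets M" "y = malg_class M B" using xyz(2) by (rule malg_cases)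
    obtain C where C: "C \<in> sets M" "z = malg_class M C" using xyz(3) by (rule malg_cases)
    have "measure M (sym_diff A C) \<le> measure M (sym_diff A B \<union> sym_diff B C)"
      using A B C by (intro finite_measure_mono) auto
    also have "\<dots> \<le> measure M (sym_diff A B) + measure M (sym_diff B C)"
      using A B C by (intro measure_Un_le) auto
    finally show ?thesis
      using A B C by (simp add: malg_dist_class)
  qed
qed

section \<open>Isomorphisms modulo null sets\<close>

definition iso_off_null ::
  "'a measure \<Rightarrow> 'b measure \<Rightarrow> ('a \<Rightarrow> 'b) \<Rightarrow> 'a set \<Rightarrow> 'b set \<Rightarrow> bool" where
  "iso_off_null M M' f N N' \<longleftrightarrow>
     N \<in> null_sets M \<and> N' \<in> null_sets M' \<and>
     bij_betw f (space M - N) (space M' - N') \<and>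
     f \<in> restrict_space M (space M - N) \<rightarrow>\<^sub>M restrict_space M' (space M' - N') \<and>
     inv_into (space M - N) f
       \<in> restrict_space M' (space M' - N') \<rightarrow>\<^sub>M restrict_space M (space M - N) \<and>
     (\<forall>A\<in>sets M. A \<subseteq> space M - N \<longrightarrow> emeasure M' (f ` A) = emeasure M A)"

definition iso_mod_null :: "'a measure \<Rightarrow> 'b measure \<Rightarrow> ('a \<Rightarrow> 'b) \<Rightarrow> bool" where
  "iso_mod_null M M' f \<longleftrightarrow> (\<exists>N N'. iso_off_null M M' f N N')"

text \<open>Passing to the completion lets \<open>sets M\<close> be either a complete sigma-algebra (for which
  \<open>completion M\<close> is just \<open>M\<close>) or a standard Borel one; the measure algebra is the same.\<close>

definition nonatomic_lebesgue_prob_space :: "'a measure \<Rightarrow> bool" where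
  "nonatomic_lebesgue_prob_space M \<longleftrightarrow>
     prob_space M \<and> (\<exists>f. iso_mod_null (completion M) (lebesgue_on {0..1::real}) f)"

definition automorphism_mod_null :: "'a measure \<Rightarrow> ('a \<Rightarrow> 'a) \<Rightarrow> bool" where
  "automorphism_mod_null M T \<longleftrightarrow> iso_mod_null M M T"

text \<open>The action on the measure algebra. An exceptional null set \<open>N\<close> has to be removed before taking
  the image, because \<open>T\<close> is arbitrary on \<open>N\<close> (so \<open>T ` N\<close> need be neither null nor measurable).
  By \<open>malg_image_class\<close> below the result depends neither on \<open>N\<close> nor on the representative.\<close>

definition malg_image :: "'a measure \<Rightarrow> ('a \<Rightarrow> 'a) \<Rightarrow> 'a set set \<Rightarrow> 'a set set" where
  "malg_image M T a =
     (\<Union>N\<in>{N. \<exists>N'. iso_off_null M M T N N'}. \<Union>A\<in>a. malg_class M (T ` (A - N)))"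

lemma iso_off_null_image_sets:
  assumes "iso_off_null M M' f N N'" "A \<in> sets M" "A \<subseteq> space M - N"
  shows "f ` A \<in> sets M'"
proof -
  let ?S = "space M - N" and ?S' = "space M' - N'" and ?g = "inv_into (space M - N) f"
  from assms have N: "N \<in> sets M" "N' \<in> sets M'" and bij: "bij_betw f ?S ?S'"
    and g: "?g \<in> restrict_space M' ?S' \<rightarrow>\<^sub>M restrict_space M ?S"
    by (auto simp: iso_off_null_def)
  have S: "?S \<in> sets M" "?S' \<in> sets M'" using N by auto
  have "A \<in> sets (restrict_space M ?S)"
    using S assms by (auto simp: sets_restrict_space_iff)
  from measurable_sets[OF g this]
  have "?g -` A \<inter> ?S' \<in> sets (restrict_space M' ?S')"
    by (simp add: space_restrict_space Int_absorb2)
  moreover have "?g -` A \<inter> ?S' = f ` A"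
  proof (rule set_eqI)
    fix y
    have "y \<in> ?g -` A \<inter> ?S'" if "y \<in> f ` A"
      using that assms(3) bij by (auto simp: bij_betw_def)
    moreover have "y \<in> f ` A" if "y \<in> ?g -` A \<inter> ?S'"
    proof -
      have "f (?g y) = y" using that bij by (intro f_inv_into_f) (auto simp: bij_betw_def)
      then show ?thesis using that by (metis IntD1 imageI vimageD)
    qed
    ultimately show "y \<in> ?g -` A \<inter> ?S' \<longleftrightarrow> y \<in> f ` A" by blast
  qed
  ultimately show ?thesis
    using S by (simp add: sets_restrict_space_iff)
qed

lemma iso_off_null_image_null:
  assumes "iso_off_null M M' f N N'" "A \<in> null_sets M" "A \<subseteq> space M - N"
  shows "f ` A \<in> null_sets M'"
  using assms iso_off_null_image_sets[OF assms(1)] by (auto simp: iso_off_null_def null_sets_def)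

lemma malg_image_class:
  assumes N: "iso_off_null M M T N N'" and A: "A \<in> sets M"
  shows "malg_image M T (malg_class M A) = malg_class M (T ` (A - N))"
proof -
  have "malg_class M (T ` (B - P)) = malg_class M (T ` (A - N))"
    if P: "iso_off_null M M T P P'" and B: "B \<in> malg_class M A" for P P' B
  proof -
    have nl: "N \<in> null_sets M" "P \<in> null_sets M" "sym_diff A B \<in> null_sets M"
      and st: "N \<in> sets M" "P \<in> sets M" "B \<in> sets M"
      using N P B by (auto simp: iso_off_null_def mem_malg_class)
    have sp: "A \<subseteq> space M" "B \<subseteq> space M" using A st sets.sets_into_space by auto
    have im1: "T ` (A - N) \<in> sets M"
      by (rule iso_off_null_image_sets[OF N]) (use A st sp in auto)
    have im2: "T ` (B - P) \<in> sets M"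
      by (rule iso_off_null_image_sets[OF P]) (use A st sp in auto)
    note im = im1 im2
    have U: "N \<union> P \<union> sym_diff A B \<in> null_sets M"
      by (rule null_sets.Un[OF null_sets.Un[OF nl(1,2)] nl(3)])
    have n1: "(A - N) \<inter> (N \<union> P \<union> sym_diff A B) \<in> null_sets M"
      by (rule null_sets_subset[OF U]) (use A st in auto)
    have n2: "(B - P) \<inter> (N \<union> P \<union> sym_diff A B) \<in> null_sets M"
      by (rule null_sets_subset[OF U]) (use A st in auto)
    have "T ` ((A - N) \<inter> (N \<union> P \<union> sym_diff A B)) \<in> null_sets M"
      by (rule iso_off_null_image_null[OF N n1]) (use sp in auto)
    moreover have "T ` ((B - P) \<inter> (N \<union> P \<union> sym_diff A B)) \<in> null_sets M"
      by (rule iso_off_null_image_null[OF P n2]) (use sp in auto)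
    ultimately have "T ` ((A - N) \<inter> (N \<union> P \<union> sym_diff A B)) \<union>
        T ` ((B - P) \<inter> (N \<union> P \<union> sym_diff A B)) \<in> null_sets M"
      by (rule null_sets.Un)
    then have "sym_diff (T ` (B - P)) (T ` (A - N)) \<in> null_sets M"
      by (rule null_sets_subset) (use im in auto)
    then show ?thesis using im by (simp add: malg_class_eq_iff)
  qed
  then show ?thesis
    using N malg_class_self[OF A] unfolding malg_image_def by blast
qed

definition ergodic_mod_null :: "'a measure \<Rightarrow> ('a \<Rightarrow> 'a) \<Rightarrow> bool" where
  "ergodic_mod_null M T \<longleftrightarrow>
     (\<forall>a\<in>malg M. malg_image M T a = a \<longrightarrow> a = malg_class M {} \<or> a = malg_class M (space M))"

definition coboundaries :: "'a measure \<Rightarrow> ('a \<Rightarrow> 'a) \<Rightarrow> 'a set set set" where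
  "coboundaries M T = {malg_add M (malg_image M T b) b | b. b \<in> malg M}"

section \<open>Meager sets\<close>

definition nowhere_dense_in :: "'a topology \<Rightarrow> 'a set \<Rightarrow> bool" where
  "nowhere_dense_in X S \<longleftrightarrow> S \<subseteq> topspace X \<and> X interior_of (X closure_of S) = {}"

definition meager_in :: "'a topology \<Rightarrow> 'a set \<Rightarrow> bool" where
  "meager_in X S \<longleftrightarrow> (\<exists>\<F>. countable \<F> \<and> (\<forall>F\<in>\<F>. nowhere_dense_in X F) \<and> S = \<Union>\<F>)"

end

theory Submission
  imports Defs
begin

text \<open>Write \<open>\<phi> B = T B + B\<close>. Countably many balls of radius \<open>1/16\<close> cover the measure algebra, so it suffices
  that \<open>\<phi>\<close> maps each of them to a nowhere dense set. If the closure of such an image contained a ball of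
  radius \<open>r\<close>, every \<open>L\<close> of measure less than \<open>r\<close> would be approximated by sets \<open>\<phi> C\<close> with
  \<open>m C < 1/8\<close>. The sum of \<open>T\<^sup>i (\<phi> C)\<close> over \<open>i < n\<close> telescopes to \<open>T\<^sup>n C + C\<close>, of measure less than \<open>1/4\<close>.
  This fails when \<open>L\<close> is the base of a Rokhlin tower of large height \<open>n\<close>: then \<open>m L \<le> 1/n < r\<close>, but the
  translates are disjoint and their sum has measure at least \<open>1/2\<close>.\<close>

section \<open>Images and preimages under isomorphisms modulo null sets\<close>

lemma iso_off_null_vimage_sets:
  assumes iso: "iso_off_null M M' f N N'" and A: "A \<in> sets M'"
  shows "f -` A \<inter> (space M - N) \<in> sets M"
proof -
  have bij: "bij_betw f (space M - N) (space M' - N')"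
    and f: "f \<in> restrict_space M (space M - N) \<rightarrow>\<^sub>M restrict_space M' (space M' - N')"
    and N: "space M - N \<in> sets M" "space M' - N' \<in> sets M'"
    using iso by (auto simp: iso_off_null_def)
  have "A \<inter> (space M' - N') \<in> sets (restrict_space M' (space M' - N'))"
    using A N by (auto simp: sets_restrict_space_iff)
  from measurable_sets[OF f this]
  have "f -` (A \<inter> (space M' - N')) \<inter> (space M - N) \<in> sets M"
    using N by (simp add: sets_restrict_space_iff space_restrict_space Int_absorb2)
  also have "f -` (A \<inter> (space M' - N')) \<inter> (space M - N) = f -` A \<inter> (space M - N)"
    using bij by (auto simp: bij_betw_def)
  finally show ?thesis .
qed

lemma iso_off_null_image_vimage:
  assumes iso: "iso_off_null M M' f N N'" and A: "A \<in> sets M'"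
  shows "f ` (f -` A \<inter> (space M - N)) = A - N'"
proof -
  have "f ` (f -` A \<inter> (space M - N)) = A \<inter> f ` (space M - N)" by blast
  also have "f ` (space M - N) = space M' - N'"
    using iso by (simp add: iso_off_null_def bij_betw_def)
  also have "A \<inter> (space M' - N') = A - N'"
    using sets.sets_into_space[OF A] by blast
  finally show ?thesis .
qed

text \<open>\<open>iso_off_null\<close> controls measures of images only. The preimage is mapped
  onto \<open>A - N'\<close>, and removing the null set \<open>N'\<close> costs nothing.\<close>

lemma measure_iso_off_null_vimage:
  assumes iso: "iso_off_null M M' f N N'" and A: "A \<in> sets M'"
  shows "measure M (f -` A \<inter> (space M - N)) = measure M' A"
proof -
  have "emeasure M (f -` A \<inter> (space M - N)) = emeasure M' (A - N')"
    using iso iso_off_null_vimage_sets[OF assms] iso_off_null_image_vimage[OF assms]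
    by (auto simp: iso_off_null_def)
  also have "\<dots> = emeasure M' A"
    using iso A by (auto simp: iso_off_null_def intro!: emeasure_Diff_null_set)
  finally show ?thesis by (simp add: measure_def)
qed

lemma measure_iso_off_null_image:
  assumes iso: "iso_off_null M M' f N N'" and A: "A \<in> sets M"
  shows "measure M' (f ` (A - N)) = measure M A"
proof -
  have N: "N \<in> null_sets M" using iso by (simp add: iso_off_null_def)
  have "A - N \<in> sets M" "A - N \<subseteq> space M - N"
    using A N sets.sets_into_space[OF A] by auto
  then have "emeasure M' (f ` (A - N)) = emeasure M (A - N)"
    using iso unfolding iso_off_null_def by blast
  also have "\<dots> = emeasure M A"
    using N A by (rule emeasure_Diff_null_set)
  finally show ?thesis by (simp add: measure_def)
qed

lemma sets_sym_diff [intro]: "A \<in> sets M \<Longrightarrow> B \<in> sets M \<Longrightarrow> sym_diff A B \<in> sets M"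
  by auto

text \<open>The interchange law of an abelian group, on which the additivity of Birkhoff sums and of
  coboundaries rests.\<close>

lemma sym_diff_interchange:
  "sym_diff (sym_diff A B) (sym_diff C D) = sym_diff (sym_diff A C) (sym_diff B D)"
  by (rule set_eqI) (simp; argo)

section \<open>Separability and small sets, carried over from the unit interval\<close>

text \<open>Separability of the measure algebra, with one net per scale. It is phrased with sets
  instead of classes so that it can be transported along point maps and completions.\<close>

definition has_countable_nets :: "'a measure \<Rightarrow> bool" where
  "has_countable_nets M \<longleftrightarrow> (\<forall>e::real>0. \<exists>\<D>. countable \<D> \<and> \<D> \<subseteq> sets M \<and>
     (\<forall>A\<in>sets M. \<exists>D\<in>\<D>. measure M (sym_diff A D) < e))"

text \<open>The form in which non-atomicity enters: it supplies the set \<open>F\<close> from which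
  a Rokhlin tower is built.\<close>

definition has_small_sets :: "'a measure \<Rightarrow> bool" where
  "has_small_sets M \<longleftrightarrow> (\<forall>e::real>0. \<exists>F\<in>sets M. 0 < measure M F \<and> measure M F < e)"

lemma has_small_sets_iso_off_null:
  assumes iso: "iso_off_null M M' f N N'" and "has_small_sets M'"
  shows "has_small_sets M"
  unfolding has_small_sets_def
proof (intro allI impI)
  fix e :: real assume "e > 0"
  then obtain F where "F \<in> sets M'" "0 < measure M' F" "measure M' F < e"
    using assms(2) by (auto simp: has_small_sets_def)
  then show "\<exists>F\<in>sets M. 0 < measure M F \<and> measure M F < e"
    using iso_off_null_vimage_sets[OF iso] measure_iso_off_null_vimage[OF iso]
    by (intro bexI[of _ "f -` F \<inter> (space M - N)"]) simp_all
qed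

text \<open>Preimages of a net form a net: approximate \<open>f\<close> (A -
  N)\<open>by\<close>W\<open>and pull back. By injectivity\<close>f \<open>(A - N)\<close> pulls
  back to \<open>A - N\<close>, so the error grows only by the null set \<open>N\<close>.\<close>

lemma has_countable_nets_iso_off_null:
  assumes "finite_measure M" and iso: "iso_off_null M M' f N N'" and nets: "has_countable_nets M'"
  shows "has_countable_nets M"
  unfolding has_countable_nets_def
proof (intro allI impI)
  interpret finite_measure M by fact
  let ?R = "\<lambda>A. f -` A \<inter> (space M - N)"
  fix e :: real assume "e > 0"
  then obtain \<D> where D: "countable \<D>" "\<D> \<subseteq> sets M'"
    "\<And>A. A \<in> sets M' \<Longrightarrow> \<exists>D\<in>\<D>. measure M' (sym_diff A D) < e"
    using nets unfolding has_countable_nets_def by meson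
  have N: "N \<in> null_sets M" and inj: "inj_on f (space M - N)"
    using iso by (simp_all add: iso_off_null_def bij_betw_def)
  have "\<exists>D\<in>?R ` \<D>. measure M (sym_diff A D) < e" if A: "A \<in> sets M" for A
  proof -
    have AN: "A - N \<in> sets M" "A - N \<subseteq> space M - N"
      using A N sets.sets_into_space[OF A] by auto
    then have fA: "f ` (A - N) \<in> sets M'" by (rule iso_off_null_image_sets[OF iso])
    from D(3)[OF this] obtain W where W: "W \<in> \<D>" "measure M' (sym_diff (f ` (A - N)) W) < e"
      by blast
    have W': "W \<in> sets M'" using W D by blast
    have X: "sym_diff (f ` (A - N)) W \<in> sets M'" using fA W' by (rule sets_sym_diff)
    have "?R (f ` (A - N)) = A - N"
      using AN(2) inj by (auto simp: inj_on_def)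
    then have "sym_diff A (?R W) \<subseteq> ?R (sym_diff (f ` (A - N)) W) \<union> N"
      by (auto simp: set_eq_iff)
    then have "measure M (sym_diff A (?R W)) \<le> measure M (?R (sym_diff (f ` (A - N)) W) \<union> N)"
      using N iso_off_null_vimage_sets[OF iso X] by (intro finite_measure_mono) auto
    also have "\<dots> = measure M' (sym_diff (f ` (A - N)) W)"
      using N iso_off_null_vimage_sets[OF iso X] measure_iso_off_null_vimage[OF iso X]
      by (simp add: measure_Un_null_set)
    finally have "measure M (sym_diff A (?R W)) < e" using W(2) by linarith
    then show ?thesis using W(1) by blast
  qed
  moreover have "countable (?R ` \<D>)" "?R ` \<D> \<subseteq> sets M"
    using D(1,2) iso_off_null_vimage_sets[OF iso] by auto
  ultimately show "\<exists>\<D>. countable \<D> \<and> \<D> \<subseteq> sets M \<and>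
      (\<forall>A\<in>sets M. \<exists>D\<in>\<D>. measure M (sym_diff A D) < e)"
    by blast
qed

lemma measure_main_part:
  "A \<in> sets (completion M) \<Longrightarrow> measure M (main_part M A) = measure (completion M) A"
  by (simp add: measure_def)

lemma has_small_sets_completion:
  assumes "has_small_sets (completion M)"
  shows "has_small_sets M"
  unfolding has_small_sets_def
proof (intro allI impI)
  fix e :: real assume "e > 0"
  then obtain F where "F \<in> sets (completion M)" "0 < measure (completion M) F"
    "measure (completion M) F < e"
    using assms unfolding has_small_sets_def by meson
  then show "\<exists>F\<in>sets M. 0 < measure M F \<and> measure M F < e"
    by (intro bexI[of _ "main_part M F"]) (simp_all add: measure_main_part)
qed

text \<open>Net elements are replaced by their main parts, which lie in \<open>sets M\<close> and
  differ from them by null sets of the completion.\<close>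

lemma has_countable_nets_completion:
  assumes "finite_measure M" and nets: "has_countable_nets (completion M)"
  shows "has_countable_nets M"
  unfolding has_countable_nets_def
proof (intro allI impI)
  interpret finite_measure M by fact
  fix e :: real assume "e > 0"
  then obtain \<D> where D: "countable \<D>" "\<D> \<subseteq> sets (completion M)"
    "\<And>A. A \<in> sets (completion M) \<Longrightarrow> \<exists>D\<in>\<D>. measure (completion M) (sym_diff A D) < e"
    using nets unfolding has_countable_nets_def by meson
  have "\<exists>D\<in>main_part M ` \<D>. measure M (sym_diff A D) < e" if A: "A \<in> sets M" for A
  proof -
    have A': "A \<in> sets (completion M)" using A by simp
    from D(3)[OF this] obtain W where W: "W \<in> \<D>" "measure (completion M) (sym_diff A W) < e"
      by blast
    have W': "W \<in> sets (completion M)" using W D by blast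
    then have X: "sym_diff A W \<in> sets (completion M)" using A' by blast
    have np: "null_part M W \<in> null_sets (completion M)"
      using null_part[OF W'] by (auto simp: null_sets_completion_iff2)
    have mp: "main_part M W \<in> sets (completion M)" using W' by simp
    have "sym_diff A (main_part M W) \<subseteq> sym_diff A W \<union> null_part M W"
      using main_part_null_part_Un[OF W'] by blast
    moreover have "emeasure (completion M) (space (completion M)) \<noteq> \<infinity>"
      by (simp add: emeasure_eq_measure)
    then have "finite_measure (completion M)" by (rule finite_measureI)
    ultimately have "measure (completion M) (sym_diff A (main_part M W))
        \<le> measure (completion M) (sym_diff A W \<union> null_part M W)"
      using np X by (intro finite_measure.finite_measure_mono) auto
    also have "\<dots> = measure (completion M) (sym_diff A W)"
      using np X by (simp add: measure_Un_null_set)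
    finally have "measure (completion M) (sym_diff A (main_part M W)) < e" using W by simp
    moreover have "sym_diff A (main_part M W) \<in> sets M"
      using A W' by (intro sets_sym_diff) auto
    ultimately have "measure M (sym_diff A (main_part M W)) < e" by simp
    then show ?thesis using W by blast
  qed
  moreover have "countable (main_part M ` \<D>)" "main_part M ` \<D> \<subseteq> sets M"
    using D(1,2) by auto
  ultimately show "\<exists>\<D>. countable \<D> \<and> \<D> \<subseteq> sets M \<and>
      (\<forall>A\<in>sets M. \<exists>D\<in>\<D>. measure M (sym_diff A D) < e)"
    by blast
qed

text \<open>Finite unions of basic open sets, cut down to \<open>S\<close>, form the net. Regularity
  gives a closed \<open>K\<close> inside \<open>A\<close> and an open \<open>U\<close> around
  \<open>K\<close>; compactness fits a finite union between them.\<close>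

lemma has_countable_nets_lebesgue_on:
  fixes S :: "'a::euclidean_space set"
  assumes "compact S"
  shows "has_countable_nets (lebesgue_on S)"
  unfolding has_countable_nets_def
proof (intro allI impI)
  fix e :: real assume e: "e > 0"
  obtain B :: "'a set set" where B: "countable B" "topological_basis B"
    using ex_countable_basis by auto
  have opB: "open b" if "b \<in> B" for b using topological_basis_open[OF B(2) that] .
  have S: "S \<in> sets lebesgue" using assms lmeasurable_compact by blast
  let ?W = "(\<lambda>G. \<Union>G \<inter> S) ` {G. finite G \<and> G \<subseteq> B}"
  have "\<Union>G \<inter> S \<in> sets (lebesgue_on S)" if "G \<subseteq> B" for G
  proof -
    have "open (\<Union>G)" using that opB by blast
    then show ?thesis using S by (auto simp: sets_restrict_space_iff)
  qed
  then have Wsets: "?W \<subseteq> sets (lebesgue_on S)" by blast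
  have "\<exists>W\<in>?W. measure (lebesgue_on S) (sym_diff A W) < e" if "A \<in> sets (lebesgue_on S)" for A
  proof -
    have A: "A \<in> sets lebesgue" "A \<subseteq> S" using that S by (auto simp: sets_restrict_space_iff)
    have e2: "e/2 > 0" using e by simp
    obtain K where K: "closed K" "K \<subseteq> A" "A - K \<in> lmeasurable"
      "emeasure lebesgue (A - K) < ennreal (e/2)"
      using sets_lebesgue_inner_closed[OF A(1) e2] by blast
    have Kl: "K \<in> sets lebesgue" using K(1) by simp
    obtain U where U: "open U" "K \<subseteq> U" "U - K \<in> lmeasurable"
      "emeasure lebesgue (U - K) < ennreal (e/2)"
      using sets_lebesgue_outer_open[OF Kl e2] by blast
    \<comment> \<open>A closed subset of the compact set \<open>S\<close> is compact.\<close>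
    have "K = S \<inter> K" using K(2) A(2) by blast
    then have "compact K" using compact_Int_closed[OF assms K(1)] by simp
    obtain B' where B': "B' \<subseteq> B" "\<Union>B' = U"
      using B(2) U(1) unfolding topological_basis_def by blast
    obtain G where G: "G \<subseteq> B'" "finite G" "K \<subseteq> \<Union>G"
      using compactE[OF \<open>compact K\<close>, of B'] U(2) B' opB by blast
    have W: "\<Union>G \<inter> S \<in> ?W" using G B' by blast
    have sub: "sym_diff A (\<Union>G \<inter> S) \<subseteq> (A - K) \<union> (U - K)"
    proof -
      have "\<Union>G \<subseteq> U" using G(1) B'(2) by blast
      then show ?thesis using G(3) A(2) K(2) by blast
    qed
    have meas: "sym_diff A (\<Union>G \<inter> S) \<in> sets (lebesgue_on S)"
      using that W Wsets by blast
    have "measure (lebesgue_on S) (sym_diff A (\<Union>G \<inter> S)) = measure lebesgue (sym_diff A (\<Union>G \<inter> S))"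
      using S A by (intro measure_restrict_space) auto
    also have "\<dots> \<le> measure lebesgue ((A - K) \<union> (U - K))"
      using sub meas S K(3) U(3) by (intro measure_mono_fmeasurable) (auto simp: sets_restrict_space_iff)
    also have "\<dots> \<le> measure lebesgue (A - K) + measure lebesgue (U - K)"
      using K(3) U(3) by (intro measure_Un_le) auto
    also have "\<dots> < e/2 + e/2"
      using K(3,4) U(3,4) e2 by (intro add_strict_mono) (simp_all add: emeasure_eq_measure2 ennreal_less_iff)
    finally show ?thesis using W by auto
  qed
  moreover have "countable ?W"
    by (intro countable_image countable_Collect_finite_subset B(1))
  ultimately show "\<exists>\<D>. countable \<D> \<and> \<D> \<subseteq> sets (lebesgue_on S) \<and>
      (\<forall>A\<in>sets (lebesgue_on S). \<exists>D\<in>\<D>. measure (lebesgue_on S) (sym_diff A D) < e)"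
    using Wsets by blast
qed

lemma has_small_sets_lebesgue_on: "has_small_sets (lebesgue_on {0..1::real})"
  unfolding has_small_sets_def
proof (intro allI impI)
  fix e :: real assume e: "e > 0"
  \<comment> \<open>The interval \<open>{0..r}\<close> must fit into the unit interval and be
    shorter than \<open>e\<close>.\<close>
  define r where "r = min 1 (e / 2)"
  have r: "0 < r" "r \<le> 1" "r < e" using e by (auto simp: r_def)
  have "measure (lebesgue_on {0..1}) {0..r} = r"
    using r by (subst measure_restrict_space) auto
  moreover have "{0..r} \<in> sets (lebesgue_on {0..1})"
    using r by (auto simp: sets_restrict_space_iff)
  ultimately show "\<exists>F\<in>sets (lebesgue_on {0..1::real}). 0 < measure (lebesgue_on {0..1}) F \<and>
      measure (lebesgue_on {0..1}) F < e"
    using r by (intro bexI[of _ "{0..r}"]) auto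
qed

text \<open>Both properties pass from the unit interval to \<open>completion M\<close> along the
  isomorphism, and from there down to \<open>M\<close>.\<close>

lemma nonatomic_lebesgue_prob_spaceD:
  assumes "nonatomic_lebesgue_prob_space M"
  shows "prob_space M" "has_countable_nets M" "has_small_sets M"
proof -
  show M: "prob_space M" using assms by (simp add: nonatomic_lebesgue_prob_space_def)
  then interpret prob_space M .
  have fin: "finite_measure M" by unfold_locales
  have "emeasure (completion M) (space (completion M)) \<noteq> \<infinity>"
    by (simp add: emeasure_eq_measure)
  then have "finite_measure (completion M)" by (rule finite_measureI)
  moreover obtain f P P' where "iso_off_null (completion M) (lebesgue_on {0..1::real}) f P P'"
    using assms by (auto simp: nonatomic_lebesgue_prob_space_def iso_mod_null_def)
  ultimately show "has_countable_nets M" "has_small_sets M"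
    using has_countable_nets_completion[OF fin] has_small_sets_completion
      has_countable_nets_iso_off_null has_small_sets_iso_off_null
      has_countable_nets_lebesgue_on[of "{0..1::real}"] has_small_sets_lebesgue_on
    by blast+
qed

section \<open>The action of an automorphism on measurable sets\<close>

lemma (in finite_measure) measure_sym_diff_le_add:
  assumes "A \<in> sets M" "B \<in> sets M"
  shows "measure M (sym_diff A B) \<le> measure M A + measure M B"
proof -
  have "measure M (sym_diff A B) \<le> measure M (A \<union> B)"
    using assms by (intro finite_measure_mono) auto
  also have "\<dots> \<le> measure M A + measure M B"
    using assms by (rule measure_Un_le)
  finally show ?thesis .
qed

text \<open>Fixing one pair of exceptional null sets turns the action on classes into the maps
  \<open>S\<close> and \<open>R\<close> on sets.\<close>

locale mp_automorphism = prob_space M for M :: "'a measure" +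
  fixes T :: "'a \<Rightarrow> 'a" and N N' :: "'a set"
  assumes iso: "iso_off_null M M T N N'"
begin

lemma N: "N \<in> null_sets M" and N': "N' \<in> null_sets M" and inj_T: "inj_on T (space M - N)"
  using iso by (simp_all add: iso_off_null_def bij_betw_def)

text \<open>Represents \<open>malg_image\<close> on sets, by
  \<open>malg_image_class\<close>.\<close>

definition S :: "'a set \<Rightarrow> 'a set" where
  "S A = T ` (A - N)"

text \<open>Inverse to \<open>S\<close> up to null sets; see \<open>S_R\<close>.\<close>

definition R :: "'a set \<Rightarrow> 'a set" where
  "R A = T -` A \<inter> (space M - N)"

lemma S_sets [simp, intro]: "A \<in> sets M \<Longrightarrow> S A \<in> sets M"
  unfolding S_def using N sets.sets_into_space[of A M]
  by (intro iso_off_null_image_sets[OF iso]) auto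

lemma measure_S [simp]: "A \<in> sets M \<Longrightarrow> measure M (S A) = measure M A"
  unfolding S_def by (rule measure_iso_off_null_image[OF iso])

text \<open>Images commute with set differences because \<open>T\<close> is injective off
  \<open>N\<close>.\<close>

lemma S_sym_diff:
  assumes "A \<in> sets M" "B \<in> sets M"
  shows "S (sym_diff A B) = sym_diff (S A) (S B)"
proof -
  have sub: "A - N \<subseteq> space M - N" "B - N \<subseteq> space M - N"
    using assms sets.sets_into_space by auto
  have "sym_diff A B - N = sym_diff (A - N) (B - N)" by blast
  moreover have "T ` ((A - N) - (B - N)) = S A - S B" "T ` ((B - N) - (A - N)) = S B - S A"
    unfolding S_def by (rule inj_on_image_set_diff[OF inj_T]; use sub in blast)+
  ultimately show ?thesis by (simp only: S_def image_Un)
qed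

lemma R_sets [simp, intro]: "A \<in> sets M \<Longrightarrow> R A \<in> sets M"
  unfolding R_def by (rule iso_off_null_vimage_sets[OF iso])

lemma measure_R [simp]: "A \<in> sets M \<Longrightarrow> measure M (R A) = measure M A"
  unfolding R_def by (rule measure_iso_off_null_vimage[OF iso])

lemma S_R: "A \<in> sets M \<Longrightarrow> S (R A) = A - N'"
  unfolding S_def R_def iso_off_null_image_vimage[OF iso, symmetric]
  by (rule arg_cong[of _ _ "image T"]) blast

lemma S_mono: "A \<subseteq> B \<Longrightarrow> S A \<subseteq> S B"
  by (auto simp: S_def)

lemma S_pow_sets [simp, intro]: "A \<in> sets M \<Longrightarrow> (S ^^ n) A \<in> sets M"
  by (induction n) auto

lemma R_pow_sets [simp, intro]: "A \<in> sets M \<Longrightarrow> (R ^^ n) A \<in> sets M"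
  by (induction n) auto

lemma measure_S_pow [simp]: "A \<in> sets M \<Longrightarrow> measure M ((S ^^ n) A) = measure M A"
  by (induction n) auto

lemma measure_R_pow [simp]: "A \<in> sets M \<Longrightarrow> measure M ((R ^^ n) A) = measure M A"
  by (induction n) auto

lemma S_pow_sym_diff:
  assumes "A \<in> sets M" "B \<in> sets M"
  shows "(S ^^ n) (sym_diff A B) = sym_diff ((S ^^ n) A) ((S ^^ n) B)"
  using assms by (induction n) (simp_all add: S_sym_diff)

section \<open>Birkhoff sums modulo 2\<close>

text \<open>A Birkhoff sum over the two-element field: a point lies in \<open>bsum n A\<close> iff
  it lies in an odd number of the first \<open>n\<close> translates.\<close>

primrec bsum :: "nat \<Rightarrow> 'a set \<Rightarrow> 'a set" where
  "bsum 0 A = {}"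
| "bsum (Suc n) A = sym_diff (bsum n A) ((S ^^ n) A)"

lemma bsum_sets [simp, intro]: "A \<in> sets M \<Longrightarrow> bsum n A \<in> sets M"
  by (induction n) auto

lemma bsum_sym_diff:
  assumes "A \<in> sets M" "B \<in> sets M"
  shows "bsum n (sym_diff A B) = sym_diff (bsum n A) (bsum n B)"
proof (induction n)
  case (Suc n)
  then show ?case unfolding bsum.simps S_pow_sym_diff[OF assms] by (simp only: sym_diff_interchange)
qed simp

text \<open>Each intermediate translate of \<open>B\<close> occurs twice and cancels. The measure of
  the sum is thus at most twice that of \<open>B\<close>, whatever \<open>n\<close> is.\<close>

lemma bsum_coboundary:
  assumes "B \<in> sets M"
  shows "bsum n (sym_diff (S B) B) = sym_diff ((S ^^ n) B) B"
proof (induction n)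
  case (Suc n)
  have "(S ^^ n) (sym_diff (S B) B) = sym_diff ((S ^^ Suc n) B) ((S ^^ n) B)"
    using assms by (subst S_pow_sym_diff) (simp_all add: funpow_swap1)
  then show ?case using Suc unfolding bsum.simps by blast
qed simp

lemma measure_bsum_le:
  assumes "A \<in> sets M"
  shows "measure M (bsum n A) \<le> n * measure M A"
proof (induction n)
  case (Suc n)
  have "measure M (bsum (Suc n) A) \<le> measure M (bsum n A) + measure M ((S ^^ n) A)"
    unfolding bsum.simps using assms by (intro measure_sym_diff_le_add) auto
  with Suc assms show ?case by (simp add: algebra_simps)
qed simp

text \<open>Disjoint translates leave nothing to cancel modulo 2.\<close>

lemma bsum_disjoint:
  assumes "disjoint_family_on (\<lambda>i. (S ^^ i) A) {..<n}"
  shows "bsum n A = (\<Union>i<n. (S ^^ i) A)"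
  using assms
proof (induction n)
  case (Suc n)
  have "bsum n A = (\<Union>i<n. (S ^^ i) A)"
    using Suc by (simp add: disjoint_family_on_def)
  moreover have "(S ^^ i) A \<inter> (S ^^ n) A = {}" if "i < n" for i
    using Suc.prems that by (simp add: disjoint_family_on_def)
  ultimately show ?case by (auto simp: lessThan_Suc)
qed simp

lemma measure_bsum_disjoint:
  assumes "A \<in> sets M" and dis: "disjoint_family_on (\<lambda>i. (S ^^ i) A) {..<n}"
  shows "measure M (bsum n A) = n * measure M A"
proof -
  have "measure M (bsum n A) = (\<Sum>i<n. measure M ((S ^^ i) A))"
    unfolding bsum_disjoint[OF dis] using assms
    by (intro finite_measure_finite_Union) auto
  then show ?thesis using assms by simp
qed

section \<open>Ergodicity and Rokhlin towers\<close>

text \<open>The union of all backward iterates is mapped into itself by \<open>R\<close>, hence is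
  \<open>S\<close>-invariant modulo null sets. Ergodicity makes its measure 0 or 1, and it contains
  \<open>F\<close>.\<close>

lemma measure_Union_R_pow:
  assumes erg: "ergodic_mod_null M T" and F: "F \<in> sets M" "measure M F > 0"
  shows "measure M (\<Union>j. (R ^^ j) F) = 1"
proof -
  let ?U = "\<Union>j. (R ^^ j) F"
  have U: "?U \<in> sets M" using F by auto
  have "R ?U \<subseteq> ?U"
  proof
    fix x assume "x \<in> R ?U"
    then obtain j where "x \<in> R ((R ^^ j) F)" by (auto simp: R_def)
    then have "x \<in> (R ^^ Suc j) F" by simp
    then show "x \<in> ?U" by blast
  qed
  then have "?U - N' \<subseteq> S ?U"
    using S_mono[of "R ?U" ?U] S_R[OF U] by simp
  then have sub: "?U - S ?U \<subseteq> N'" by blast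
  have n1: "?U - S ?U \<in> null_sets M"
    by (rule null_sets_subset[OF N' _ sub]) (use U in auto)
  \<comment> \<open>Two sets of equal measure have differences of equal measure, so the other
    inclusion also holds modulo null sets.\<close>
  have "measure M (S ?U - ?U) = measure M (S ?U) - measure M (S ?U \<inter> ?U)"
    using U by (subst finite_measure_Diff') auto
  also have "\<dots> = measure M ?U - measure M (?U \<inter> S ?U)"
    using U by (simp add: Int_commute)
  also have "\<dots> = measure M (?U - S ?U)"
    using U by (subst finite_measure_Diff') auto
  also have "\<dots> = 0" using n1 by (simp add: measure_eq_0_null_sets)
  finally have "S ?U - ?U \<in> null_sets M"
    using U by (auto simp: null_sets_def emeasure_eq_measure)
  with n1 have "sym_diff (S ?U) ?U \<in> null_sets M" by auto
  then have "malg_image M T (malg_class M ?U) = malg_class M ?U"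
    using U S_sets[OF U] unfolding malg_image_class[OF iso U] S_def[symmetric]
    by (subst malg_class_eq_iff)
  then have "malg_class M ?U = malg_class M {} \<or> malg_class M ?U = malg_class M (space M)"
    using erg malg_class_in_malg[OF U] unfolding ergodic_mod_null_def by blast
  then have "malg_measure M (malg_class M ?U) = measure M {} \<or>
    malg_measure M (malg_class M ?U) = measure M (space M)"
    by (metis malg_measure_class sets.empty_sets sets.top)
  then have "measure M ?U = 0 \<or> measure M ?U = 1"
    using malg_measure_class[OF U] by (simp add: prob_space)
  moreover have "measure M F \<le> measure M ?U"
    using U UN_upper[of 0 UNIV "\<lambda>j. (R ^^ j) F"] by (intro finite_measure_mono) simp_all
  ultimately show ?thesis using F by linarith
qed

text \<open>\<open>E k\<close> below is the set of points that first hit \<open>F\<close> at time \<open>k\<close>. Since \<open>S\<close> maps \<open>E (Suc k)\<close> into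
  \<open>E k\<close>, the measures of the \<open>E k\<close> decrease, which makes every \<open>n\<close>-th of them carry
  about a fraction \<open>1/n\<close> of the space.\<close>

lemma rokhlin_tower:
  assumes erg: "ergodic_mod_null M T" and n: "n > 0"
    and F: "F \<in> sets M" "measure M F > 0" "n * measure M F \<le> 1/4"
  shows "\<exists>L\<in>sets M. disjoint_family_on (\<lambda>i. (S ^^ i) L) {..<n} \<and> n * measure M L \<ge> 1/2"
proof -
  define E where "E k = (R ^^ k) F - (\<Union>j<k. (R ^^ j) F)" for k
  have E [simp]: "E k \<in> sets M" for k using F by (auto simp: E_def)
  have E_dis: "j = k" if "x \<in> E j" "x \<in> E k" for x j k
    using that by (cases j k rule: linorder_cases) (auto simp: E_def)
  have SE: "S (E (Suc k)) \<subseteq> E k" for k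
  proof
    fix y assume "y \<in> S (E (Suc k))"
    then obtain x where x: "y = T x" "x \<in> E (Suc k)" by (auto simp: S_def)
    then have xs: "x \<in> space M - N" "T x \<in> (R ^^ k) F" by (auto simp: E_def R_def)
    have "T x \<notin> (R ^^ j) F" if "j < k" for j
    proof
      assume "T x \<in> (R ^^ j) F"
      then have "x \<in> (R ^^ Suc j) F" using xs by (auto simp: R_def)
      moreover have "Suc j < Suc k" using that by simp
      ultimately show False using x(2) unfolding E_def by blast
    qed
    then show "y \<in> E k" using xs x by (auto simp: E_def)
  qed
  have SpowE: "(S ^^ i) (E (i + k)) \<subseteq> E k" for i k
  proof (induction i arbitrary: k)
    case (Suc i)
    have "(S ^^ Suc i) (E (Suc i + k)) = S ((S ^^ i) (E (i + Suc k)))" by simp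
    also have "\<dots> \<subseteq> E k" using S_mono[OF Suc[of "Suc k"]] SE by blast
    finally show ?case .
  qed simp
  have "decseq (\<lambda>k. measure M (E k))"
  proof (rule decseq_SucI)
    fix k
    have "measure M (E (Suc k)) = measure M (S (E (Suc k)))" by simp
    also have "\<dots> \<le> measure M (E k)" using SE by (intro finite_measure_mono) auto
    finally show "measure M (E (Suc k)) \<le> measure M (E k)" .
  qed
  then have anti: "measure M (E k) \<le> measure M (E j)" if "j \<le> k" for j k
    using that by (rule decseqD)
  have EU: "(\<Union>k<m. E k) = (\<Union>k<m. (R ^^ k) F)" for m
    by (induction m) (auto simp: lessThan_Suc E_def)
  have sumE: "measure M (\<Union>k<m. (R ^^ k) F) = (\<Sum>k<m. measure M (E k))" for m
    unfolding EU[symmetric]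
    by (rule finite_measure_finite_Union) (auto simp: disjoint_family_on_def dest: E_dis)
  have "(\<lambda>m. measure M (\<Union>k<m. (R ^^ k) F)) \<longlonglongrightarrow> measure M (\<Union>m. \<Union>k<m. (R ^^ k) F)"
    by (rule finite_Lim_measure_incseq) (use F in \<open>auto simp: incseq_def dest: less_le_trans\<close>)
  moreover have "(\<Union>m. \<Union>k<m. (R ^^ k) F) = (\<Union>k. (R ^^ k) F)" by auto
  ultimately have "(\<lambda>m. measure M (\<Union>k<m. (R ^^ k) F)) \<longlonglongrightarrow> 1"
    using measure_Union_R_pow[OF erg F(1,2)] by simp
  \<comment> \<open>Dropping the first \<open>n\<close> of the sets \<open>E k\<close>, of total
    measure at most 1/4, from more than 3/4 will still leave 1/2.\<close>
  then have "eventually (\<lambda>m. measure M (\<Union>k<m. (R ^^ k) F) > 3/4) sequentially"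
    by (rule order_tendstoD) simp
  then obtain Q where Q: "\<And>m. m \<ge> Q \<Longrightarrow> (\<Sum>k<m. measure M (E k)) > 3/4"
    unfolding sumE eventually_sequentially by blast
  \<comment> \<open>\<open>L\<close> takes the last level of each block of \<open>n\<close>
    consecutive ones. It can thus be moved by \<open>S\<close> up to \<open>n - 1\<close> times
    without leaving the blocks.\<close>
  define L where "L = (\<Union>q<Q. E (q * n + (n - 1)))"
  have L: "L \<in> sets M" by (auto simp: L_def)
  have mL: "measure M L = (\<Sum>q<Q. measure M (E (q * n + (n - 1))))"
    unfolding L_def
  proof (rule finite_measure_finite_Union)
    have "E (q * n + (n - 1)) \<inter> E (q' * n + (n - 1)) = {}" if "q \<noteq> q'" for q q'
    proof -
      have "q * n + (n - 1) \<noteq> q' * n + (n - 1)" using that n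
        by (metis add_right_cancel mult_cancel2 not_gr_zero)
      then show ?thesis using E_dis by blast
    qed
    then show "disjoint_family_on (\<lambda>q. E (q * n + (n - 1))) {..<Q}"
      by (simp add: disjoint_family_on_def)
  qed auto
  have S_pow_L: "\<exists>q. x \<in> E (q * n + (n - 1 - i))" if i: "i < n" and x: "x \<in> (S ^^ i) L" for i x
  proof -
    have "(S ^^ i) (\<Union>q<Q. G q) = (\<Union>q<Q. (S ^^ i) (G q))" for G
      by (induction i) (auto simp: S_def)
    with x obtain q where "x \<in> (S ^^ i) (E (q * n + (n - 1)))"
      unfolding L_def by auto
    moreover have "q * n + (n - 1) = i + (q * n + (n - 1 - i))" using i by simp
    ultimately have "x \<in> E (q * n + (n - 1 - i))" using SpowE by (metis subsetD)
    then show ?thesis ..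
  qed
  have dis: "disjoint_family_on (\<lambda>i. (S ^^ i) L) {..<n}"
  proof (unfold disjoint_family_on_def, intro ballI impI, rule ccontr)
    fix i j assume ij: "i \<in> {..<n}" "j \<in> {..<n}" "i \<noteq> j" "(S ^^ i) L \<inter> (S ^^ j) L \<noteq> {}"
    then obtain x where "x \<in> (S ^^ i) L" "x \<in> (S ^^ j) L" by blast
    then obtain q q' where "x \<in> E (q * n + (n - 1 - i))" "x \<in> E (q' * n + (n - 1 - j))"
      using S_pow_L ij by (meson lessThan_iff)
    then have "q * n + (n - 1 - i) = q' * n + (n - 1 - j)" by (rule E_dis)
    \<comment> \<open>The translate by \<open>i\<close> occupies only levels congruent to
      \<open>n - 1 - i\<close> modulo \<open>n\<close>, so distinct translates have distinct
      residues.\<close>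
    then have "(q * n + (n - 1 - i)) mod n = (q' * n + (n - 1 - j)) mod n" by simp
    then have "n - 1 - i = n - 1 - j" using n by simp
    then show False using ij by auto
  qed
  \<comment> \<open>With the shift by \<open>n\<close>, every index in the block of \<open>q\<close>
    exceeds \<open>q * n + (n - 1)\<close>, so monotonicity bounds all \<open>n\<close> terms by the
    one chosen for \<open>L\<close>.\<close>
  have "(\<Sum>k<Q * n. measure M (E (k + n))) =
      (\<Sum>q<Q. \<Sum>k\<in>{q * n..<q * n + n}. measure M (E (k + n)))"
    by (rule sum.nat_group[symmetric])
  also have "\<dots> \<le> (\<Sum>q<Q. \<Sum>k\<in>{q * n..<q * n + n}. measure M (E (q * n + (n - 1))))"
    by (intro sum_mono anti) auto
  also have "\<dots> = n * measure M L" by (simp only: mL sum_constant sum_distrib_left) simp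
  finally have 1: "(\<Sum>k<Q * n. measure M (E (k + n))) \<le> n * measure M L" .
  have "measure M (E k) \<le> measure M F" for k
  proof -
    have "measure M (E k) \<le> measure M ((R ^^ k) F)"
      using F by (intro finite_measure_mono) (auto simp: E_def)
    then show ?thesis using F by simp
  qed
  then have "(\<Sum>k<n. measure M (E k)) \<le> (\<Sum>k<n. measure M F)" by (intro sum_mono)
  then have 2: "(\<Sum>k<n. measure M (E k)) \<le> 1/4" using F by simp
  have sum_split: "(\<Sum>k<n + m. measure M (E k)) =
      (\<Sum>k<n. measure M (E k)) + (\<Sum>k<m. measure M (E (k + n)))" for m
    by (induction m) (simp_all add: add_ac)
  have "n + Q * n \<ge> Q" using n by (cases n) auto
  then have "(\<Sum>k<n + Q * n. measure M (E k)) > 3/4" by (rule Q)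
  then have "n * measure M L \<ge> 1/2" using 1 2 unfolding sum_split by linarith
  with L dis show ?thesis by blast
qed

section \<open>Nowhere density and the countable cover\<close>

text \<open>Two sets in the ball differ by some \<open>C\<close> of measure below 1/8, so the
  telescoped sum stays below 1/4. Two approximation errors below \<open>1 / (16 * n)\<close> add
  less than 1/8 over \<open>n\<close> translates. The total is below 3/8, against at least 1/2 for
  the tower.\<close>

lemma nowhere_dense_coboundaries_of_small_ball:
  assumes erg: "ergodic_mod_null M T"
    and small: "has_small_sets M"
    and D: "D \<in> sets M"
  shows "nowhere_dense_in (Metric_space.mtopology (malg M) (malg_dist M))
     {malg_class M (sym_diff (S B) B) | B. B \<in> sets M \<and> measure M (sym_diff B D) < 1/16}"
    (is "nowhere_dense_in _ ?C")
proof -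
  interpret A: Metric_space "malg M" "malg_dist M"
    by (rule Metric_space_malg) unfold_locales
  have CM: "?C \<subseteq> malg M" by (auto intro!: malg_class_in_malg)
  let ?I = "A.mtopology interior_of (A.mtopology closure_of ?C)"
  have False if a: "a \<in> ?I" for a
  proof -
    have "openin A.mtopology ?I" by simp
    then obtain r where r: "r > 0" "A.mball a r \<subseteq> ?I"
      using a unfolding A.openin_mtopology by blast
    have aM: "a \<in> malg M"
      using a interior_of_subset_topspace[of A.mtopology] by (auto simp: A.topspace_mtopology)
    then obtain A where A: "A \<in> sets M" "a = malg_class M A" by (rule malg_cases)
    \<comment> \<open>A tower of this height has a base of measure at most \<open>1 / n\<close>,
      which is below \<open>r\<close>.\<close>
    define n where "n = Suc (nat \<lceil>1 / r\<rceil>)"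
    have n: "n > 0" "1 / r < n" by (auto simp: n_def) linarith
    obtain F where F: "F \<in> sets M" "0 < measure M F" "measure M F < 1 / (4 * n)"
      using small n unfolding has_small_sets_def
      by (metis of_nat_0_less_iff zero_less_divide_1_iff mult_pos_pos zero_less_numeral)
    have "n * measure M F \<le> 1/4" using F(3) n by (simp add: field_simps)
    from rokhlin_tower[OF erg n(1) F(1,2) this] obtain L where L: "L \<in> sets M"
      "disjoint_family_on (\<lambda>i. (S ^^ i) L) {..<n}" "n * measure M L \<ge> 1/2" by blast
    have mL: "measure M (bsum n L) = n * measure M L"
      by (rule measure_bsum_disjoint[OF L(1,2)])
    then have "n * measure M L \<le> 1" by (metis prob_le_1)
    moreover have "1 < n * r" using n(2) r(1) by (simp add: field_simps)
    ultimately have "n * measure M L < n * r" by linarith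
    then have "measure M L < r" using n by simp
    have approx: "\<exists>B\<in>sets M. measure M (sym_diff B D) < 1/16 \<and>
        measure M (sym_diff X (sym_diff (S B) B)) < 1 / (16 * n)"
      if X: "X \<in> sets M" "malg_dist M a (malg_class M X) < r" for X
    proof -
      have "malg_class M X \<in> A.mball a r"
        using X aM malg_class_in_malg[OF X(1)] by simp
      then have "malg_class M X \<in> A.mtopology closure_of ?C"
        by (rule subsetD[OF subset_trans[OF r(2) interior_of_subset]])
      moreover have "1 / (16 * n) > 0" using n by simp
      ultimately obtain c where c: "c \<in> ?C" "c \<in> A.mball (malg_class M X) (1 / (16 * n))"
        unfolding A.metric_closure_of by blast
      then obtain B where B: "B \<in> sets M" "measure M (sym_diff B D) < 1/16"
        "c = malg_class M (sym_diff (S B) B)" by blast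
      have "malg_dist M (malg_class M X) c < 1 / (16 * n)" using c(2) by simp
      then have "measure M (sym_diff X (sym_diff (S B) B)) < 1 / (16 * n)"
        unfolding B(3) using X B(1) by (subst (asm) malg_dist_class) auto
      with B show ?thesis by blast
    qed
    \<comment> \<open>Both \<open>A\<close> and \<open>A + L\<close> represent points of the ball
      around \<open>a\<close>, and their sum is \<open>L\<close>. Approximating each by a coboundary
      therefore approximates \<open>L\<close> by the coboundary of \<open>B1 + B2\<close>.\<close>
    have sAL: "sym_diff A (sym_diff A L) = L" by blast
    have "malg_dist M a (malg_class M A) < r" using A aM r by simp
    from approx[OF A(1) this] obtain B1 where B1: "B1 \<in> sets M" "measure M (sym_diff B1 D) < 1/16"
      "measure M (sym_diff A (sym_diff (S B1) B1)) < 1 / (16 * n)" by blast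
    have "malg_dist M a (malg_class M (sym_diff A L)) < r"
      unfolding A(2) using A(1) L(1) \<open>measure M L < r\<close> sAL by (subst malg_dist_class) auto
    from approx[OF _ this] obtain B2 where B2: "B2 \<in> sets M" "measure M (sym_diff B2 D) < 1/16"
      "measure M (sym_diff (sym_diff A L) (sym_diff (S B2) B2)) < 1 / (16 * n)"
      using A(1) L(1) by blast
    define C where "C = sym_diff B1 B2"
    have C: "C \<in> sets M" using B1 B2 by (auto simp: C_def)
    have "C = sym_diff (sym_diff B1 D) (sym_diff B2 D)" by (auto simp: C_def)
    then have mC: "measure M C < 1/8"
      using measure_sym_diff_le_add[of "sym_diff B1 D" "sym_diff B2 D"] B1 B2 D by auto
    \<comment> \<open>\<open>Y\<close> is the error in approximating \<open>L\<close> by the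
      coboundary of \<open>C\<close>. By additivity of \<open>S\<close> it is the sum of the two
      earlier errors.\<close>
    define Y where "Y = sym_diff L (sym_diff (S C) C)"
    have Y: "Y \<in> sets M" unfolding Y_def by (intro sets_sym_diff S_sets L C)
    have "Y = sym_diff (sym_diff A (sym_diff (S B1) B1)) (sym_diff (sym_diff A L) (sym_diff (S B2) B2))"
      unfolding Y_def C_def S_sym_diff[OF B1(1) B2(1)] sym_diff_interchange[of "S B1"]
      by (subst sym_diff_interchange[of A "sym_diff (S B1) B1"]) (simp only: sAL)
    then have "measure M Y \<le> measure M (sym_diff A (sym_diff (S B1) B1))
       + measure M (sym_diff (sym_diff A L) (sym_diff (S B2) B2))"
      using A(1) L(1) B1(1) B2(1) by (simp only:) (intro measure_sym_diff_le_add sets_sym_diff S_sets)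
    then have "measure M Y < 1 / (8 * n)" using B1(3) B2(3) by simp
    then have "n * measure M Y < 1/8" using n by (simp add: field_simps)
    then have mY: "measure M (bsum n Y) < 1/8" using measure_bsum_le[OF Y, of n] by linarith
    have "L = sym_diff Y (sym_diff (S C) C)" by (auto simp: Y_def)
    then have "bsum n L = sym_diff (bsum n Y) (sym_diff ((S ^^ n) C) C)"
      using bsum_sym_diff[OF Y, of "sym_diff (S C) C" n] bsum_coboundary[OF C, of n] C by auto
    then have "measure M (bsum n L) \<le> measure M (bsum n Y) + measure M (sym_diff ((S ^^ n) C) C)"
      using Y C by (simp only:) (intro measure_sym_diff_le_add sets_sym_diff S_pow_sets bsum_sets)
    also have "measure M (sym_diff ((S ^^ n) C) C) \<le> measure M ((S ^^ n) C) + measure M C"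
      using C by (intro measure_sym_diff_le_add) auto
    finally show False using mL L(3) mY mC C by simp
  qed
  then show ?thesis using CM by (auto simp: nowhere_dense_in_def A.topspace_mtopology)
qed

end

theorem mainTheorem2:
  fixes M :: "'a measure" and T :: "'a \<Rightarrow> 'a"
  assumes "nonatomic_lebesgue_prob_space M"
    and "automorphism_mod_null M T"
    and "ergodic_mod_null M T"
  shows "meager_in (Metric_space.mtopology (malg M) (malg_dist M)) (coboundaries M T)"
proof -
  note M = nonatomic_lebesgue_prob_spaceD[OF assms(1)]
  obtain N N' where iso: "iso_off_null M M T N N'"
    using assms(2) by (auto simp: automorphism_mod_null_def iso_mod_null_def)
  interpret prob_space M by (rule M(1))
  interpret mp_automorphism M T N N' by unfold_locales (rule iso)
  have "(0::real) < 1/16" by simp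
  then obtain \<D> where D: "countable \<D>" "\<D> \<subseteq> sets M"
    "\<And>B. B \<in> sets M \<Longrightarrow> \<exists>D\<in>\<D>. measure M (sym_diff B D) < 1/16"
    using M(2) unfolding has_countable_nets_def by meson
  \<comment> \<open>The image under the coboundary map of the ball of radius 1/16 around
    \<open>D\<close>; as \<open>D\<close> runs through \<open>\<D>\<close>, these images exhaust the
    coboundaries.\<close>
  let ?C = "\<lambda>D. {malg_class M (sym_diff (S B) B) | B. B \<in> sets M \<and> measure M (sym_diff B D) < 1/16}"
  have cob: "malg_add M (malg_image M T (malg_class M B)) (malg_class M B) =
      malg_class M (sym_diff (S B) B)" if "B \<in> sets M" for B
    using malg_add_class[OF S_sets[OF that] that]
    by (simp only: malg_image_class[OF iso that] S_def)
  have "coboundaries M T = {malg_class M (sym_diff (S B) B) | B. B \<in> sets M}"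
    unfolding coboundaries_def using cob malg_class_in_malg malg_cases
    by (smt (verit) Collect_cong)
  also have "\<dots> = \<Union>(?C ` \<D>)" using D(3) by blast
  finally have "coboundaries M T = \<Union>(?C ` \<D>)" .
  moreover have "nowhere_dense_in (Metric_space.mtopology (malg M) (malg_dist M)) (?C D)"
    if "D \<in> \<D>" for D
    using nowhere_dense_coboundaries_of_small_ball[OF assms(3) M(3)] D(2) that by blast
  ultimately show ?thesis
    unfolding meager_in_def using D(1) by (intro exI[of _ "?C ` \<D>"]) auto
qed

end
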